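(* Let $\mathscr{T} \subset \mathscr{L}(H)$ be a bounded abelian multiplicative semigroup of operators on a Hilbert space $H$. Suppose there are two positive real constants $m$ and $M$ such that for any $T \in \mathscr{T}$ and $x \in H$, $m \|x\| \leqslant \|T x\| \leqslant M \|x\|$. Then there exists an invertible positive operator $A \in \mathscr{L}(H)$ such that $m I \leqslant A \leqslant M I$ and $A T A^{-1}$ is an isometry for each $T \in \mathscr{T}$.
   Context: Hilbert spaces are real or complex; semigroups are non-empty. $\mathscr{L}(H)$ is the algebra of all bounded linear operators from $H$ into $H$, and $I$ is the identity operator. The order $\leqslant$ is the usual order on self-adjoint operators. An isometry need not be surjective. *)

theory Defs
  imports "HOL-Analysis.Analysis" "HOL-Library.Complex_Order"
begin

(* The distribution has real inner product spaces (real_inner) but no complex ones.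
   A complex inner product space is described here together with its underlying real
   structure: scaleR is the restriction of scaleC to the reals and the real inner product
   is Re of the complex one. Hence norm x = sqrt (Re (cinner x x)), the norm of the complex
   inner product. cinner is linear in the first argument. Positive definiteness of cinner
   comes from real_inner. *)
class complex_inner = real_inner +
  fixes scaleC :: "complex \<Rightarrow> 'a \<Rightarrow> 'a"
    and cinner :: "'a \<Rightarrow> 'a \<Rightarrow> complex"
  assumes scaleC_add_right: "scaleC c (x + y) = scaleC c x + scaleC c y"
    and scaleC_add_left: "scaleC (c + d) x = scaleC c x + scaleC d x"
    and scaleC_scaleC: "scaleC c (scaleC d x) = scaleC (c * d) x"
    and scaleC_of_real: "scaleC (complex_of_real r) x = r *\<^sub>R x"
    and cinner_commute: "cinner x y = cnj (cinner y x)"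
    and cinner_add_left: "cinner (x + y) z = cinner x z + cinner y z"
    and cinner_scaleC_left: "cinner (scaleC c x) y = c * cinner x y"
    and Re_cinner: "Re (cinner x y) = inner x y"

instantiation complex :: complex_inner
begin

definition scaleC_complex :: "complex \<Rightarrow> complex \<Rightarrow> complex"
  where "scaleC_complex c x = c * x"

definition cinner_complex :: "complex \<Rightarrow> complex \<Rightarrow> complex"
  where "cinner_complex x y = x * cnj y"

instance
  by standard
    (simp_all add: scaleC_complex_def cinner_complex_def inner_complex_def algebra_simps
      scaleR_conv_of_real)

end

(* The real-linear bounded operators form the type of blinfuns; the operator norm does not
   depend on whether the scalars are taken real or complex. *)
definition bounded_clinear_ops :: "('a::complex_inner \<Rightarrow>\<^sub>L 'a) set"
  where "bounded_clinear_ops =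
    {T. \<forall>c x. blinfun_apply T (scaleC c x) = scaleC c (blinfun_apply T x)}"

definition abelian_op_semigroup :: "('a::real_normed_vector \<Rightarrow>\<^sub>L 'a) set \<Rightarrow> bool"
  where "abelian_op_semigroup S \<longleftrightarrow>
    S \<noteq> {} \<and> (\<forall>T\<in>S. \<forall>U\<in>S. T o\<^sub>L U \<in> S) \<and> (\<forall>T\<in>S. \<forall>U\<in>S. T o\<^sub>L U = U o\<^sub>L T)"

definition isometry_op :: "('a::real_normed_vector \<Rightarrow>\<^sub>L 'a) \<Rightarrow> bool"
  where "isometry_op T \<longleftrightarrow> (\<forall>x. norm (blinfun_apply T x) = norm x)"

definition mutually_inverse_ops ::
    "('a::real_normed_vector \<Rightarrow>\<^sub>L 'a) \<Rightarrow> ('a \<Rightarrow>\<^sub>L 'a) \<Rightarrow> bool"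
  where "mutually_inverse_ops A B \<longleftrightarrow> A o\<^sub>L B = id_blinfun \<and> B o\<^sub>L A = id_blinfun"

(* In the next three definitions ip is the inner product: inner in the real case, cinner in
   the complex case. For complex values, z \<le> w means Re z \<le> Re w and Im z = Im w. *)
definition self_adjoint_op ::
    "('a::real_normed_vector \<Rightarrow> 'a \<Rightarrow> 'k) \<Rightarrow> ('a \<Rightarrow>\<^sub>L 'a) \<Rightarrow> bool"
  where "self_adjoint_op ip A \<longleftrightarrow>
    (\<forall>x y. ip (blinfun_apply A x) y = ip x (blinfun_apply A y))"

definition op_le ::
    "('a::real_normed_vector \<Rightarrow> 'a \<Rightarrow> 'k::order) \<Rightarrow> ('a \<Rightarrow>\<^sub>L 'a) \<Rightarrow> ('a \<Rightarrow>\<^sub>L 'a) \<Rightarrow> bool"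
  where "op_le ip A B \<longleftrightarrow> self_adjoint_op ip A \<and> self_adjoint_op ip B \<and>
    (\<forall>x. ip (blinfun_apply A x) x \<le> ip (blinfun_apply B x) x)"

definition positive_op ::
    "('a::real_normed_vector \<Rightarrow> 'a \<Rightarrow> 'k::order) \<Rightarrow> ('a \<Rightarrow>\<^sub>L 'a) \<Rightarrow> bool"
  where "positive_op ip A \<longleftrightarrow> op_le ip 0 A"

end

theory Submission
  imports Defs
begin

text \<open>
  Write \<open>F\<close> for the semigroup. An invertible \<open>A\<close> turns every \<open>T \<in> F\<close> into an isometry
  \<open>A T A\<^sup>-\<^sup>1\<close> exactly when the form \<open>b x y = A x \<bullet> A y\<close> satisfies \<open>b (T x) (T y) = b x y\<close> for
  all \<open>T \<in> F\<close>. So it suffices to find a symmetric bilinear form \<open>b\<close> that is invariant under \<open>F\<close>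
  and lies between \<open>m\<^sup>2\<close> and \<open>M\<^sup>2\<close> times the inner product, and to take for \<open>A\<close> the positive
  square root of the operator that represents \<open>b\<close>.

  The form comes from a fixed-point argument of Markov and Kakutani
  (\<open>commuting_maps_invariant_function\<close>): the forms with the required bounds along \<open>F\<close> are a
  nonempty, convex and pointwise compact set of functions on pairs of vectors, it contains
  \<open>(x, y) \<mapsto> T x \<bullet> T y\<close> for \<open>T \<in> F\<close>, and the commuting maps \<open>b \<mapsto> b \<circ> (T, T)\<close> send it to itself;
  hence they have a common fixed point in it (\<open>invariant_bilinear_form\<close>).

  The Riesz representation theorem, proved by minimising \<open>\<parallel>x\<parallel>\<^sup>2 - 2 f x\<close>, gives an operator \<open>D\<close> with
  \<open>D x \<bullet> y = b x y\<close> and \<open>m\<^sup>2 I \<le> D \<le> M\<^sup>2 I\<close>. With \<open>D = M\<^sup>2 (I - E)\<close>, a square root \<open>M (I - Y)\<close>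
  of \<open>D\<close> amounts to a solution of \<open>Y = (E + Y\<^sup>2) / 2\<close>, and the right-hand side is a contraction of
  the ball of radius \<open>1 - m / M\<close> into itself. The radius of this ball is what makes the bound
  \<open>m I \<le> A\<close> come out with the given constant; positivity of \<open>Y\<close> gives \<open>A \<le> M I\<close>.

  For complex scalars the real result is applied to the larger semigroup of all \<open>c T\<close> with
  \<open>\<bar>c\<bar> = 1\<close>. Invariance under both \<open>T\<close> and \<open>\<i> T\<close> makes \<open>b\<close> invariant under multiplication by
  \<open>\<i>\<close>, so \<open>D\<close> commutes with \<open>\<i>\<close>, and so does its square root.
\<close>

section \<open>Invariant functions for commuting maps\<close>

definition cesaro_average :: "('i \<Rightarrow> 'i) \<Rightarrow> nat \<Rightarrow> ('i \<Rightarrow> real) \<Rightarrow> 'i \<Rightarrow> real" where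
  "cesaro_average T N q x = (\<Sum>n<N. q ((T ^^ n) x)) / real N"

lemma comp_funpow_mem:
  assumes inv: "\<And>q. q \<in> K \<Longrightarrow> q \<circ> T \<in> K" and "q \<in> K"
  shows "q \<circ> T ^^ n \<in> K"
proof (induction n)
  case (Suc n)
  have "q \<circ> T ^^ Suc n = (q \<circ> T ^^ n) \<circ> T"
    by (simp only: funpow_Suc_right comp_assoc)
  then show ?case using inv[OF Suc.IH] by (simp only:)
qed (use \<open>q \<in> K\<close> in simp)

lemma cesaro_average_mem:
  assumes convex: "\<And>p q t. p \<in> K \<Longrightarrow> q \<in> K \<Longrightarrow> 0 \<le> t \<Longrightarrow> t \<le> 1 \<Longrightarrow>
      (\<lambda>x. (1 - t) * p x + t * q x) \<in> K"
    and inv: "\<And>q. q \<in> K \<Longrightarrow> q \<circ> T \<in> K"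
    and "q \<in> K" and "N > 0"
  shows "cesaro_average T N q \<in> K"
proof -
  have iter: "q \<circ> T ^^ n \<in> K" for n
    using inv \<open>q \<in> K\<close> by (rule comp_funpow_mem)
  show ?thesis
    using \<open>N > 0\<close>
  proof (induction N rule: nat_induct_non_zero)
    case 1
    have "cesaro_average T 1 q = q"
      by (simp add: cesaro_average_def fun_eq_iff)
    then show ?case using \<open>q \<in> K\<close> by simp
  next
    case (Suc N)
    \<comment> \<open>the average over \<open>N + 1\<close> iterates is a convex combination of the one over \<open>N\<close> iterates and
      the last iterate, which has weight \<open>1 / (N + 1)\<close>\<close>
    define t where "t = 1 / real (Suc N)"
    have t: "0 \<le> t" "t \<le> 1" "(1 - t) / real N = t"
      using Suc.hyps by (simp_all add: t_def divide_simps)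
    have "cesaro_average T (Suc N) q x = (1 - t) * cesaro_average T N q x + t * (q \<circ> T ^^ N) x"
      for x
    proof -
      let ?S = "\<Sum>n<N. q ((T ^^ n) x)"
      have "(1 - t) * cesaro_average T N q x = (1 - t) / real N * ?S"
        by (simp add: cesaro_average_def)
      also have "\<dots> = t * ?S" by (simp only: t(3))
      finally show ?thesis
        by (simp add: cesaro_average_def t_def add_divide_distrib)
    qed
    then have "cesaro_average T (Suc N) q =
        (\<lambda>x. (1 - t) * cesaro_average T N q x + t * (q \<circ> T ^^ N) x)"
      by (rule ext)
    then show ?case using convex[OF Suc.IH iter[of N] t(1,2)] by (simp only:)
  qed
qed

lemma cesaro_average_commute:
  assumes "S \<circ> T = T \<circ> S"
  shows "cesaro_average S L (cesaro_average T N q) = cesaro_average T N (cesaro_average S L q)"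
proof -
  have one: "(S ^^ k) (T x) = T ((S ^^ k) x)" for k x
    using assms by (induction k) (auto simp: fun_eq_iff)
  have "(S ^^ k) ((T ^^ n) x) = (T ^^ n) ((S ^^ k) x)" for k n x
    by (induction n) (auto simp: one)
  then show ?thesis
    unfolding cesaro_average_def fun_eq_iff
    by (subst (1 2) sum_divide_distrib[symmetric], subst sum.swap) (simp add: mult.commute)
qed

text \<open>
  Shifting the average by \<open>T\<close> only exchanges its first term for a new last one.
\<close>

lemma cesaro_average_almost_invariant:
  assumes "\<And>n. \<bar>q ((T ^^ n) x)\<bar> \<le> B"
  shows "\<bar>cesaro_average T N q (T x) - cesaro_average T N q x\<bar> \<le> 2 * B / real N"
proof -
  have "(T ^^ n) (T x) = (T ^^ Suc n) x" for n
    by (simp add: funpow_swap1)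
  then have "(\<Sum>n<N. q ((T ^^ n) (T x))) - (\<Sum>n<N. q ((T ^^ n) x)) = q ((T ^^ N) x) - q x"
    using sum_lessThan_telescope[of "\<lambda>n. q ((T ^^ n) x)" N] by (simp only: sum_subtractf) simp
  then have "cesaro_average T N q (T x) - cesaro_average T N q x = (q ((T ^^ N) x) - q x) / real N"
    by (simp add: cesaro_average_def diff_divide_distrib[symmetric])
  moreover have "\<bar>q ((T ^^ N) x) - q x\<bar> \<le> 2 * B"
    using assms[of N] assms[of 0] by auto
  ultimately show ?thesis
    by (simp add: divide_right_mono)
qed

text \<open>
  Tychonoff's theorem: such a set is a closed part of a product of compact intervals.
\<close>

lemma compact_pointwise_bounded_closed:
  fixes K :: "('i \<Rightarrow> real) set"
  assumes "closed K" and "\<And>q x. q \<in> K \<Longrightarrow> \<bar>q x\<bar> \<le> B x"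
  shows "compact K"
proof -
  have "compactin (product_topology (\<lambda>i::'i. euclidean::real topology) UNIV)
      (\<Pi>\<^sub>E x\<in>UNIV. {- B x..B x})"
    by (simp add: compactin_PiE)
  then have "compact (\<Pi>\<^sub>E x\<in>UNIV. {- B x..B x})"
    by (simp add: euclidean_product_topology)
  then have "compact ((\<Pi>\<^sub>E x\<in>UNIV. {- B x..B x}) \<inter> K)"
    using assms(1) by (rule compact_Int_closed)
  moreover have "(\<Pi>\<^sub>E x\<in>UNIV. {- B x..B x}) \<inter> K = K"
    using assms(2) by (auto simp: abs_le_iff minus_le_iff)
  ultimately show ?thesis by simp
qed

text \<open>
  The Markov--Kakutani theorem for composition operators. For one map \<open>T\<close> and one length \<open>N\<close>, an
  average of length \<open>N\<close> is invariant under \<open>T\<close> up to \<open>2 B x / N\<close>. Averaging successively over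
  finitely many maps keeps all these approximate invariances, since the averaging operators commute
  and so the result is an average over each of the maps. Compactness of \<open>K\<close> then yields a member
  that satisfies all of them, for every \<open>T\<close> and every \<open>N\<close>.
\<close>

theorem commuting_maps_invariant_function:
  fixes K :: "('i \<Rightarrow> real) set" and F :: "('i \<Rightarrow> 'i) set"
  assumes "K \<noteq> {}" and "closed K"
    and bound: "\<And>q x. q \<in> K \<Longrightarrow> \<bar>q x\<bar> \<le> B x"
    and convex: "\<And>p q t. p \<in> K \<Longrightarrow> q \<in> K \<Longrightarrow> 0 \<le> t \<Longrightarrow> t \<le> 1 \<Longrightarrow>
      (\<lambda>x. (1 - t) * p x + t * q x) \<in> K"
    and inv: "\<And>T q. T \<in> F \<Longrightarrow> q \<in> K \<Longrightarrow> q \<circ> T \<in> K"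
    and comm: "\<And>S T. S \<in> F \<Longrightarrow> T \<in> F \<Longrightarrow> S \<circ> T = T \<circ> S"
  shows "\<exists>q\<in>K. \<forall>T\<in>F. \<forall>x. q (T x) = q x"
proof -
  define C where "C i = {q. \<forall>x. \<bar>q (fst i x) - q x\<bar> \<le> 2 * B x / real (snd i)}"
    for i :: "('i \<Rightarrow> 'i) \<times> nat"
  have closed_C: "closed (C i)" for i
    unfolding C_def
    by (intro closed_Collect_all closed_Collect_le continuous_on_rabs continuous_on_diff
        continuous_on_const continuous_on_product_coordinates)
  have mem: "cesaro_average T N q \<in> K" if "T \<in> F" "N > 0" "q \<in> K" for T N q
    using that by (intro cesaro_average_mem[of K] convex inv)
  have iter: "q \<circ> T ^^ n \<in> K" if "T \<in> F" "q \<in> K" for T q n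
    using inv[OF \<open>T \<in> F\<close>] \<open>q \<in> K\<close> by (rule comp_funpow_mem)
  have avg_in_C: "cesaro_average T N q \<in> C (T, N)" if "T \<in> F" "q \<in> K" for T N q
  proof -
    have "\<bar>q ((T ^^ n) x)\<bar> \<le> B x" for n x
      using bound[OF iter[OF that], of n x] by simp
    then show ?thesis
      unfolding C_def fst_conv snd_conv mem_Collect_eq by (intro allI cesaro_average_almost_invariant)
  qed
  \<comment> \<open>membership in the image of \<open>K\<close> under an averaging operator survives further averaging, unlike
    the explicit bound in \<open>C\<close>\<close>
  have common: "\<exists>q\<in>K. \<forall>i\<in>J. q \<in> cesaro_average (fst i) (snd i) ` K"
    if "finite J" "J \<subseteq> F \<times> {0<..}" for J
    using that
  proof (induction J)
    case empty
    then show ?case using \<open>K \<noteq> {}\<close> by auto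
  next
    case (insert i J)
    have i: "fst i \<in> F" "snd i > 0" and J: "J \<subseteq> F \<times> {0<..}" using insert.prems by auto
    from insert.IH[OF J] obtain q
      where q: "q \<in> K" "\<forall>j\<in>J. q \<in> cesaro_average (fst j) (snd j) ` K" ..
    let ?q = "cesaro_average (fst i) (snd i) q"
    have "?q \<in> cesaro_average (fst j) (snd j) ` K" if "j \<in> J" for j
    proof -
      from q(2) that obtain p where p: "p \<in> K" "q = cesaro_average (fst j) (snd j) p" by blast
      have "fst j \<in> F" using that J by auto
      then have "?q = cesaro_average (fst j) (snd j) (cesaro_average (fst i) (snd i) p)"
        unfolding p(2) by (intro cesaro_average_commute comm i)
      then show ?thesis using mem[OF i p(1)] by (rule image_eqI)
    qed
    then have "\<forall>j\<in>insert i J. ?q \<in> cesaro_average (fst j) (snd j) ` K"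
      using imageI[OF q(1)] by auto
    then show ?case using mem[OF i q(1)] by (intro bexI)
  qed
  have "compact K"
    using \<open>closed K\<close> bound by (rule compact_pointwise_bounded_closed)
  then have "K \<inter> (\<Inter>i\<in>F \<times> {0<..}. C i) \<noteq> {}"
  proof (rule compact_imp_fip_image)
    fix J :: "(('i \<Rightarrow> 'i) \<times> nat) set"
    assume J: "finite J" "J \<subseteq> F \<times> {0<..}"
    from common[OF J] obtain q
      where q: "q \<in> K" "\<forall>i\<in>J. q \<in> cesaro_average (fst i) (snd i) ` K" ..
    have "q \<in> C i" if "i \<in> J" for i
    proof -
      from q(2) that obtain p where "p \<in> K" "q = cesaro_average (fst i) (snd i) p" by blast
      moreover have "fst i \<in> F" using that J(2) by auto
      ultimately show ?thesis using avg_in_C[of "fst i" p "snd i"] by simp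
    qed
    then have "q \<in> K \<inter> (\<Inter>i\<in>J. C i)" using q(1) by blast
    then show "K \<inter> (\<Inter>i\<in>J. C i) \<noteq> {}" by blast
  qed (rule closed_C)
  then obtain q where q: "q \<in> K" "q \<in> (\<Inter>i\<in>F \<times> {0<..}. C i)"
    by blast
  have "q (T x) = q x" if "T \<in> F" for T x
  proof -
    have "\<bar>q (T x) - q x\<bar> \<le> 2 * B x / real (Suc n)" for n
    proof -
      have "q \<in> C (T, Suc n)" using q(2) that by blast
      then show ?thesis unfolding C_def by simp
    qed
    then have "\<bar>q (T x) - q x\<bar> \<le> 0"
      by (intro LIMSEQ_le_const[OF LIMSEQ_Suc[OF lim_const_over_n[of "2 * B x"]]]) blast
    then show ?thesis by simp
  qed
  then show ?thesis using q(1) by blast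
qed

section \<open>Invariant bilinear forms\<close>

text \<open>
  A form is viewed as one function on pairs, on which \<open>T \<in> F\<close> acts by composition with
  \<open>map_prod T T\<close>. The bounds in the set \<open>K\<close> of candidates are required along \<open>F\<close>, for all
  \<open>b (P x) (P y)\<close>, because a bound on \<open>b\<close> alone would not pass to \<open>b \<circ> map_prod T T\<close>; the identity
  is adjoined to \<open>F\<close> so that \<open>b\<close> itself is bounded as well.
\<close>

lemma invariant_bilinear_form:
  fixes F :: "('a::real_inner \<Rightarrow> 'a) set"
  assumes "F \<noteq> {}" and "m \<ge> 0" and "M \<ge> 0"
    and lin: "\<And>T. T \<in> F \<Longrightarrow> linear T"
    and comp: "\<And>S T. S \<in> F \<Longrightarrow> T \<in> F \<Longrightarrow> S \<circ> T \<in> F"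
    and comm: "\<And>S T. S \<in> F \<Longrightarrow> T \<in> F \<Longrightarrow> S \<circ> T = T \<circ> S"
    and lower: "\<And>T x. T \<in> F \<Longrightarrow> m * norm x \<le> norm (T x)"
    and upper: "\<And>T x. T \<in> F \<Longrightarrow> norm (T x) \<le> M * norm x"
  obtains b :: "'a \<Rightarrow> 'a \<Rightarrow> real" where "\<And>y. linear (\<lambda>x. b x y)" and "\<And>x y. b x y = b y x"
    and "\<And>x y. \<bar>b x y\<bar> \<le> M\<^sup>2 * (norm x * norm y)" and "\<And>x. m\<^sup>2 * (norm x)\<^sup>2 \<le> b x x"
    and "\<And>T x y. T \<in> F \<Longrightarrow> b (T x) (T y) = b x y"
proof -
  define K :: "('a \<times> 'a \<Rightarrow> real) set" where "K = {b.
    (\<forall>x y z. b (x + y, z) = b (x, z) + b (y, z)) \<and>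
    (\<forall>r x y. b (r *\<^sub>R x, y) = r * b (x, y)) \<and>
    (\<forall>x y. b (x, y) = b (y, x)) \<and>
    (\<forall>P\<in>insert id F. \<forall>x y. \<bar>b (P x, P y)\<bar> \<le> M\<^sup>2 * (norm x * norm y)) \<and>
    (\<forall>P\<in>insert id F. \<forall>x. m\<^sup>2 * (norm x)\<^sup>2 \<le> b (P x, P x))}"
  have K_I: "b \<in> K"
    if "\<And>x y z. b (x + y, z) = b (x, z) + b (y, z)" "\<And>r x y. b (r *\<^sub>R x, y) = r * b (x, y)"
      "\<And>x y. b (x, y) = b (y, x)"
      "\<And>P x y. P \<in> insert id F \<Longrightarrow> \<bar>b (P x, P y)\<bar> \<le> M\<^sup>2 * (norm x * norm y)"
      "\<And>P x. P \<in> insert id F \<Longrightarrow> m\<^sup>2 * (norm x)\<^sup>2 \<le> b (P x, P x)" for b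
    unfolding K_def by (intro CollectI conjI allI ballI that)
  have K_D: "(\<forall>x y z. b (x + y, z) = b (x, z) + b (y, z)) \<and>
      (\<forall>r x y. b (r *\<^sub>R x, y) = r * b (x, y)) \<and> (\<forall>x y. b (x, y) = b (y, x)) \<and>
      (\<forall>P\<in>insert id F. \<forall>x y. \<bar>b (P x, P y)\<bar> \<le> M\<^sup>2 * (norm x * norm y)) \<and>
      (\<forall>P\<in>insert id F. \<forall>x. m\<^sup>2 * (norm x)\<^sup>2 \<le> b (P x, P x))" if "b \<in> K" for b
    using that unfolding K_def mem_Collect_eq .
  note K_add = K_D[THEN conjunct1, rule_format]
    and K_scale = K_D[THEN conjunct2, THEN conjunct1, rule_format]
    and K_sym = K_D[THEN conjunct2, THEN conjunct2, THEN conjunct1, rule_format]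
    and K_abs = K_D[THEN conjunct2, THEN conjunct2, THEN conjunct2, THEN conjunct1, rule_format]
    and K_lower = K_D[THEN conjunct2, THEN conjunct2, THEN conjunct2, THEN conjunct2, rule_format]
  have "\<exists>b\<in>K. \<forall>T\<in>(\<lambda>T. map_prod T T) ` F. \<forall>z. b (T z) = b z"
  proof (rule commuting_maps_invariant_function)
    obtain T where T: "T \<in> F" using \<open>F \<noteq> {}\<close> by blast
    have TP: "T \<circ> P \<in> F" if "P \<in> insert id F" for P
      using that comp T by auto
    have "(\<lambda>(x, y). T x \<bullet> T y) \<in> K"
    proof (rule K_I, unfold prod.case)
      show "T x \<bullet> T y = T y \<bullet> T x" for x y by (rule inner_commute)
      fix P :: "'a \<Rightarrow> 'a" and x y :: 'a assume P: "P \<in> insert id F"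
      have "\<bar>T (P x) \<bullet> T (P y)\<bar> \<le> norm (T (P x)) * norm (T (P y))"
        by (rule Cauchy_Schwarz_ineq2)
      also have "\<dots> \<le> (M * norm x) * (M * norm y)"
        using upper[OF TP[OF P]] \<open>M \<ge> 0\<close> by (intro mult_mono) auto
      finally show "\<bar>T (P x) \<bullet> T (P y)\<bar> \<le> M\<^sup>2 * (norm x * norm y)"
        by (simp add: power2_eq_square mult_ac)
      show "m\<^sup>2 * (norm x)\<^sup>2 \<le> T (P x) \<bullet> T (P x)"
        using power_mono[OF lower[OF TP[OF P], of x], of 2] \<open>m \<ge> 0\<close>
        by (simp add: power_mult_distrib power2_norm_eq_inner)
    qed (simp_all add: linear_add[OF lin[OF T]] linear_scale[OF lin[OF T]] inner_add_left)
    then show "K \<noteq> {}" by blast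
    have "closed {b :: 'a \<times> 'a \<Rightarrow> real. \<forall>P\<in>insert id F. \<forall>x y.
        \<bar>b (P x, P y)\<bar> \<le> M\<^sup>2 * (norm x * norm y)}"
      unfolding Collect_ball_eq
      by (intro closed_INT ballI closed_Collect_all closed_Collect_le continuous_on_rabs
          continuous_on_const continuous_on_product_coordinates)
    moreover have "closed {b :: 'a \<times> 'a \<Rightarrow> real. \<forall>P\<in>insert id F. \<forall>x.
        m\<^sup>2 * (norm x)\<^sup>2 \<le> b (P x, P x)}"
      unfolding Collect_ball_eq
      by (intro closed_INT ballI closed_Collect_all closed_Collect_le continuous_on_const
          continuous_on_product_coordinates)
    moreover have "closed {b :: 'a \<times> 'a \<Rightarrow> real. \<forall>x y z. b (x + y, z) = b (x, z) + b (y, z)}"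
      "closed {b :: 'a \<times> 'a \<Rightarrow> real. \<forall>r x y. b (r *\<^sub>R x, y) = r * b (x, y)}"
      "closed {b :: 'a \<times> 'a \<Rightarrow> real. \<forall>x y. b (x, y) = b (y, x)}"
      by (intro closed_Collect_all closed_Collect_eq continuous_on_add continuous_on_mult
          continuous_on_const continuous_on_product_coordinates)+
    ultimately show "closed K"
      unfolding K_def by (intro closed_Collect_conj)
    show "\<bar>b z\<bar> \<le> (case z of (x, y) \<Rightarrow> M\<^sup>2 * (norm x * norm y))" if "b \<in> K" for b z
      using K_abs[OF that, of id] by (cases z) auto
    show "(\<lambda>z. (1 - t) * b z + t * c z) \<in> K" if b: "b \<in> K" and c: "c \<in> K" and t: "0 \<le> t" "t \<le> 1"
      for b c t
    proof (rule K_I)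
      show "(1 - t) * b (x + y, z) + t * c (x + y, z) =
          (1 - t) * b (x, z) + t * c (x, z) + ((1 - t) * b (y, z) + t * c (y, z))" for x y z
        unfolding K_add[OF b] K_add[OF c] by (simp add: distrib_left)
      show "(1 - t) * b (r *\<^sub>R x, y) + t * c (r *\<^sub>R x, y) =
          r * ((1 - t) * b (x, y) + t * c (x, y))" for r x y
        unfolding K_scale[OF b] K_scale[OF c] by (simp add: distrib_left mult_ac)
      show "(1 - t) * b (x, y) + t * c (x, y) = (1 - t) * b (y, x) + t * c (y, x)" for x y
        by (simp only: K_sym[OF b, of x y] K_sym[OF c, of x y])
      fix P :: "'a \<Rightarrow> 'a" and x y :: 'a assume P: "P \<in> insert id F"
      let ?u = "M\<^sup>2 * (norm x * norm y)"
      have "(1 - t) * b (P x, P y) + t * c (P x, P y) \<le> ?u"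
        using K_abs[OF b P, of x y] K_abs[OF c P, of x y] t by (intro convex_bound_le) auto
      moreover have "(1 - t) * (- b (P x, P y)) + t * (- c (P x, P y)) \<le> ?u"
        using K_abs[OF b P, of x y] K_abs[OF c P, of x y] t by (intro convex_bound_le) auto
      ultimately show "\<bar>(1 - t) * b (P x, P y) + t * c (P x, P y)\<bar> \<le> ?u"
        by (simp add: abs_le_iff)
      have "(1 - t) * (- b (P x, P x)) + t * (- c (P x, P x)) \<le> - (m\<^sup>2 * (norm x)\<^sup>2)"
        using K_lower[OF b P, of x] K_lower[OF c P, of x] t by (intro convex_bound_le) auto
      then show "m\<^sup>2 * (norm x)\<^sup>2 \<le> (1 - t) * b (P x, P x) + t * c (P x, P x)"
        by simp
    qed
    show "b \<circ> T \<in> K" if T: "T \<in> (\<lambda>T. map_prod T T) ` F" and b: "b \<in> K" for T b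
    proof -
      from T obtain S where S: "S \<in> F" "T = map_prod S S" by blast
      have SP: "S \<circ> P \<in> insert id F" if "P \<in> insert id F" for P
        using that S(1) comp by auto
      have "(\<lambda>(x, y). b (S x, S y)) \<in> K"
      proof (rule K_I, unfold prod.case)
        show "b (S (x + y), S z) = b (S x, S z) + b (S y, S z)" for x y z
          unfolding linear_add[OF lin[OF S(1)]] by (rule K_add[OF b])
        show "b (S (r *\<^sub>R x), S y) = r * b (S x, S y)" for r x y
          unfolding linear_scale[OF lin[OF S(1)]] by (rule K_scale[OF b])
        show "b (S x, S y) = b (S y, S x)" for x y by (rule K_sym[OF b])
        fix P :: "'a \<Rightarrow> 'a" and x y :: 'a assume P: "P \<in> insert id F"
        show "\<bar>b (S (P x), S (P y))\<bar> \<le> M\<^sup>2 * (norm x * norm y)"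
          using K_abs[OF b SP[OF P]] by simp
        show "m\<^sup>2 * (norm x)\<^sup>2 \<le> b (S (P x), S (P x))"
          using K_lower[OF b SP[OF P]] by simp
      qed
      moreover have "b \<circ> T = (\<lambda>(x, y). b (S x, S y))"
        by (auto simp: S(2))
      ultimately show ?thesis by simp
    qed
    show "S \<circ> T = T \<circ> S"
      if "S \<in> (\<lambda>T. map_prod T T) ` F" "T \<in> (\<lambda>T. map_prod T T) ` F" for S T
      using that by (elim imageE) (simp only: map_prod_compose[symmetric] comm)
  qed
  then obtain b where b: "b \<in> K" and inv: "\<forall>T\<in>(\<lambda>T. map_prod T T) ` F. \<forall>z. b (T z) = b z"
    by blast
  show thesis
  proof (rule that[of "\<lambda>x y. b (x, y)"])
    show "linear (\<lambda>x. b (x, y))" for y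
      by (rule linearI) (simp_all only: K_add[OF b] K_scale[OF b] real_scaleR_def)
    show "b (x, y) = b (y, x)" for x y by (rule K_sym[OF b])
    show "\<bar>b (x, y)\<bar> \<le> M\<^sup>2 * (norm x * norm y)" for x y
      using K_abs[OF b, of id] by simp
    show "m\<^sup>2 * (norm x)\<^sup>2 \<le> b (x, x)" for x
      using K_lower[OF b, of id] by simp
    show "b (T x, T y) = b (x, y)" if "T \<in> F" for T x y
      using bspec[OF inv imageI[OF that], rule_format, of "(x, y)"] by simp
  qed
qed

section \<open>Representing bounded forms by operators\<close>

text \<open>
  The representing vector is the minimiser of \<open>J x = \<parallel>x\<parallel>\<^sup>2 - 2 f x\<close>, which for \<open>f y = z \<bullet> y\<close> is
  \<open>\<parallel>x - z\<parallel>\<^sup>2 - \<parallel>z\<parallel>\<^sup>2\<close>. The parallelogram law makes minimising sequences Cauchy, and at a minimiser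
  all directional derivatives of \<open>J\<close> vanish.
\<close>

lemma riesz_representation:
  fixes f :: "'a::{real_inner,complete_space} \<Rightarrow> real"
  assumes "bounded_linear f"
  shows "\<exists>z. \<forall>y. z \<bullet> y = f y"
proof -
  interpret f: bounded_linear f by fact
  define J where "J x = (norm x)\<^sup>2 - 2 * f x" for x
  define I where "I = Inf (range J)"
  obtain C where C: "\<And>x. norm (f x) \<le> norm x * C" using f.bounded by blast
  have "- (C\<^sup>2) \<le> J x" for x
  proof -
    have "0 \<le> (norm x - C)\<^sup>2" by simp
    then show ?thesis using C[of x] unfolding J_def by (simp add: power2_diff abs_le_iff)
  qed
  then have bdd: "bdd_below (range J)" by (intro bdd_belowI) auto
  have I_le: "I \<le> J x" for x
    unfolding I_def by (rule cInf_lower[OF _ bdd]) simp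
  have parallelogram: "(norm (x - y))\<^sup>2 \<le> 2 * (J x - I) + 2 * (J y - I)" for x y
  proof -
    have "J ((1/2) *\<^sub>R (x + y)) = (norm (x + y))\<^sup>2 / 4 - (f x + f y)"
      by (simp only: J_def f.scaleR f.add norm_scaleR power_mult_distrib) (simp add: power_divide field_simps)
    moreover have "(norm (x - y))\<^sup>2 + (norm (x + y))\<^sup>2 = 2 * (norm x)\<^sup>2 + 2 * (norm y)\<^sup>2"
      by (simp add: power2_norm_eq_inner inner_simps inner_commute[of y x])
    ultimately have "(norm (x - y))\<^sup>2 = 2 * J x + 2 * J y - 4 * J ((1/2) *\<^sub>R (x + y))"
      by (simp add: J_def)
    then show ?thesis using I_le[of "(1/2) *\<^sub>R (x + y)"] by simp
  qed
  have "\<exists>x. J x < I + 1 / real (Suc n)" for n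
    using cInf_lessD[of "range J" "I + 1 / real (Suc n)"] unfolding I_def by auto
  then obtain u where u: "\<And>n. J (u n) < I + 1 / real (Suc n)" by metis
  have "Cauchy u"
  proof (rule metric_CauchyI)
    fix e :: real assume "e > 0"
    then obtain n0 where n0: "4 / e\<^sup>2 < real n0" using reals_Archimedean2 by blast
    have "dist (u i) (u j) < e" if "i \<ge> n0" "j \<ge> n0" for i j
    proof -
      have small: "J (u k) - I < e\<^sup>2 / 4" if "k \<ge> n0" for k
      proof -
        have "4 / e\<^sup>2 < real (Suc k)" using n0 that by simp
        then have "1 / real (Suc k) < e\<^sup>2 / 4" using \<open>e > 0\<close> by (simp add: field_simps)
        then show ?thesis using u[of k] by simp
      qed
      have "(norm (u i - u j))\<^sup>2 < e\<^sup>2"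
        using parallelogram[of "u i" "u j"] small[OF that(1)] small[OF that(2)] by simp
      then show ?thesis
        using \<open>e > 0\<close> by (simp add: dist_norm power_less_imp_less_base)
    qed
    then show "\<exists>n0. \<forall>i\<ge>n0. \<forall>j\<ge>n0. dist (u i) (u j) < e" by blast
  qed
  then obtain z where z: "u \<longlonglongrightarrow> z" using Cauchy_convergent convergent_def by blast
  have "(\<lambda>n. J (u n)) \<longlonglongrightarrow> J z"
    unfolding J_def by (intro tendsto_intros z f.tendsto)
  moreover have "(\<lambda>n. I + 1 / real (Suc n)) \<longlonglongrightarrow> I + 0"
    by (intro tendsto_add tendsto_const LIMSEQ_Suc[OF lim_const_over_n])
  ultimately have "J z \<le> I"
    using LIMSEQ_le[of "\<lambda>n. J (u n)" "J z" "\<lambda>n. I + 1 / real (Suc n)" I] u less_imp_le by auto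
  have "z \<bullet> y = f y" for y
  proof (rule ccontr)
    define d where "d = z \<bullet> y - f y"
    assume "z \<bullet> y \<noteq> f y"
    then have "d \<noteq> 0" by (simp add: d_def)
    \<comment> \<open>move from \<open>z\<close> along \<open>y\<close> by a step that makes \<open>J\<close> smaller; the summand 1 in \<open>s\<close> only
      avoids a division by zero\<close>
    define s where "s = (norm y)\<^sup>2 + 1"
    have "s > 0" by (simp add: s_def add_nonneg_pos)
    define t where "t = - d / s"
    have "J (z + t *\<^sub>R y) = J z + 2 * t * d + t\<^sup>2 * (norm y)\<^sup>2"
      by (simp add: J_def d_def power2_norm_eq_inner f.scaleR f.add inner_simps inner_commute[of y z]
          right_diff_distrib) (simp add: power2_eq_square distrib_left)
    then have "0 \<le> 2 * t * d + t\<^sup>2 * (norm y)\<^sup>2"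
      using I_le[of "z + t *\<^sub>R y"] \<open>J z \<le> I\<close> by simp
    also have "\<dots> \<le> 2 * t * d + t\<^sup>2 * s"
      by (simp add: s_def mult_left_mono)
    also have "\<dots> = - (d\<^sup>2 / s)"
      using \<open>s > 0\<close> by (simp add: t_def field_simps power2_eq_square)
    also have "\<dots> < 0" using \<open>d \<noteq> 0\<close> \<open>s > 0\<close> by simp
    finally show False by simp
  qed
  then show ?thesis by blast
qed

lemma bounded_form_operator:
  fixes b :: "'a::{real_inner,complete_space} \<Rightarrow> 'a \<Rightarrow> real"
  assumes linear_left: "\<And>y. linear (\<lambda>x. b x y)" and linear_right: "\<And>x. linear (b x)"
    and bound: "\<And>x y. \<bar>b x y\<bar> \<le> C * (norm x * norm y)"
  shows "\<exists>D :: 'a \<Rightarrow>\<^sub>L 'a. \<forall>x y. blinfun_apply D x \<bullet> y = b x y"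
proof -
  have b_bl: "bounded_linear (b x)" for x
    using bound[of x]
    by (intro bounded_linear_intro[where K = "C * norm x"]) 
      (simp_all add: linear_add[OF linear_right] linear_scale[OF linear_right] mult_ac)
  obtain d where d: "\<And>x y. d x \<bullet> y = b x y"
    using choice[of "\<lambda>x z. \<forall>y. z \<bullet> y = b x y"] riesz_representation[OF b_bl] by blast
  have "bounded_linear d"
  proof (rule bounded_linear_intro)
    show "d (x + y) = d x + d y" for x y
      by (rule vector_eq_rdot[THEN iffD1]) (simp add: d inner_add_left linear_add[OF linear_left])
    show "d (r *\<^sub>R x) = r *\<^sub>R d x" for r x
      by (rule vector_eq_rdot[THEN iffD1]) (simp add: d linear_scale[OF linear_left])
    show "norm (d x) \<le> norm x * C" for x
    proof -
      have "norm (d x) * norm (d x) \<le> (norm x * C) * norm (d x)"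
        using bound[of x "d x"] d[of x "d x"]
        by (simp add: dot_square_norm power2_eq_square mult_ac)
      moreover have "0 \<le> norm x * C"
      proof (cases "x = 0")
        case False
        have "0 \<le> C * (norm x * norm x)" using bound[of x x] by linarith
        then show ?thesis using False by (simp add: zero_le_mult_iff mult_le_0_iff)
      qed simp
      ultimately show ?thesis
        by (cases "d x = 0") (auto simp: mult_le_cancel_right)
    qed
  qed
  then have "\<forall>x y. blinfun_apply (Blinfun d) x \<bullet> y = b x y"
    by (simp add: d bounded_linear_Blinfun_apply)
  then show ?thesis by blast
qed

section \<open>Square roots of positive operators\<close>

text \<open>
  Polarisation: \<open>4 (E x \<bullet> y)\<close> is the difference of the quadratic form of \<open>E\<close> at \<open>x + y\<close> and at
  \<open>x - y\<close>, so it is at most \<open>r \<parallel>x + y\<parallel>\<^sup>2\<close>. The norm of \<open>E x\<close> is read off by taking \<open>y\<close> in the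
  direction of \<open>E x\<close> and of the same length as \<open>x\<close>.
\<close>

lemma norm_positive_operator_le:
  fixes E :: "'a::real_inner \<Rightarrow>\<^sub>L 'a"
  assumes sa: "\<And>x y. E x \<bullet> y = x \<bullet> E y"
    and pos: "\<And>x. 0 \<le> E x \<bullet> x" and le: "\<And>x. E x \<bullet> x \<le> r * (norm x)\<^sup>2" and "r \<ge> 0"
  shows "norm E \<le> r"
proof (rule norm_blinfun_bound[OF \<open>r \<ge> 0\<close>])
  fix x
  show "norm (E x) \<le> r * norm x"
  proof (cases "E x = 0 \<or> x = 0")
    case False
    define y where "y = (norm x / norm (E x)) *\<^sub>R E x"
    have norm_y: "norm y = norm x" using False by (simp add: y_def)
    have "E x \<bullet> y = norm x * norm (E x)"
      using False by (simp add: y_def dot_square_norm power2_eq_square)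
    moreover have "E y \<bullet> x = E x \<bullet> y"
      using sa[of y x] by (simp add: inner_commute)
    ultimately have "4 * (norm x * norm (E x)) = E (x + y) \<bullet> (x + y) - E (x - y) \<bullet> (x - y)"
      by (simp add: blinfun.add_right blinfun.diff_right inner_simps)
    also have "\<dots> \<le> r * (norm (x + y))\<^sup>2"
      using pos[of "x - y"] le[of "x + y"] by simp
    also have "\<dots> \<le> r * (2 * norm x)\<^sup>2"
      using norm_triangle_ineq[of x y] norm_y \<open>r \<ge> 0\<close> by (intro mult_left_mono power_mono) auto
    finally have "norm x * norm (E x) \<le> norm x * (r * norm x)"
      by (simp add: power2_eq_square mult_ac)
    then show ?thesis using False by simp
  qed (use \<open>r \<ge> 0\<close> in auto)
qed

text \<open>
  A type that is both normed and complete need not belong to the class \<open>banach\<close>, so the operators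
  into it do not form an instance of \<open>complete_space\<close>; completeness is expressed through \<open>UNIV\<close>.
\<close>

lemma complete_blinfun_UNIV:
  "complete (UNIV :: ('a::real_normed_vector \<Rightarrow>\<^sub>L 'b::{real_normed_vector,complete_space}) set)"
proof (rule completeI)
  fix X :: "nat \<Rightarrow> 'a \<Rightarrow>\<^sub>L 'b"
  assume X: "Cauchy X"
  obtain C where C: "\<And>n. norm (X n) \<le> C"
    using Cauchy_Bseq[OF X] unfolding Bseq_def by blast
  have "convergent (\<lambda>n. X n x)" for x
    using bounded_linear.Cauchy[OF blinfun.bounded_linear_left X] by (rule Cauchy_convergent)
  then obtain v where v: "\<And>x. (\<lambda>n. X n x) \<longlonglongrightarrow> v x" unfolding convergent_def by metis
  have bl: "bounded_linear v"
  proof (rule bounded_linear_intro)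
    show "v (x + y) = v x + v y" for x y
      using LIMSEQ_unique[OF v tendsto_add[OF v v, of x y, folded blinfun.add_right]] .
    show "v (r *\<^sub>R x) = r *\<^sub>R v x" for r x
      using LIMSEQ_unique[OF v tendsto_scaleR[OF tendsto_const v, of r x, folded blinfun.scaleR_right]] .
    show "norm (v x) \<le> norm x * C" for x
    proof (rule LIMSEQ_le_const2[OF tendsto_norm[OF v]])
      have "norm (X n x) \<le> norm x * C" for n
        using norm_blinfun[of "X n" x] mult_right_mono[OF C[of n], of "norm x"]
        by (simp add: mult.commute)
      then show "\<exists>N. \<forall>n\<ge>N. norm (X n x) \<le> norm x * C" by blast
    qed
  qed
  have "X \<longlonglongrightarrow> Blinfun v"
  proof (rule LIMSEQ_I)
    fix e :: real assume "e > 0"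
    then obtain N where N: "\<And>i j. i \<ge> N \<Longrightarrow> j \<ge> N \<Longrightarrow> norm (X i - X j) < e / 2"
      using CauchyD[OF X, of "e / 2"] by auto
    have "norm (X i - Blinfun v) \<le> e / 2" if "i \<ge> N" for i
    proof (rule norm_blinfun_bound)
      fix x
      have "(\<lambda>j. norm (X i x - X j x)) \<longlonglongrightarrow> norm (X i x - v x)"
        by (intro tendsto_intros v)
      moreover have "norm (X i x - X j x) \<le> e / 2 * norm x" if "j \<ge> N" for j
        using norm_blinfun[of "X i - X j" x]
          mult_right_mono[OF less_imp_le[OF N[OF \<open>i \<ge> N\<close> that]], of "norm x"]
        by (simp add: blinfun.diff_left)
      ultimately have "norm (X i x - v x) \<le> e / 2 * norm x"
        using LIMSEQ_le_const2 by blast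
      then show "norm ((X i - Blinfun v) x) \<le> e / 2 * norm x"
        by (simp add: blinfun.diff_left bounded_linear_Blinfun_apply[OF bl])
    qed (use \<open>e > 0\<close> in simp)
    then show "\<exists>N. \<forall>i\<ge>N. norm (X i - Blinfun v) < e"
      using \<open>e > 0\<close> by (intro exI[of _ N]) force
  qed
  then show "\<exists>l\<in>UNIV. X \<longlonglongrightarrow> l" by blast
qed

text \<open>
  Left and right inverses are fixed points of the contractions \<open>W \<mapsto> I + W Y\<close> and \<open>Z \<mapsto> I + Y Z\<close>;
  they agree by associativity.
\<close>

lemma neumann_inverse:
  fixes Y :: "'a::{real_normed_vector,complete_space} \<Rightarrow>\<^sub>L 'a"
  assumes "norm Y < 1"
  shows "\<exists>Z. mutually_inverse_ops (id_blinfun - Y) Z"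
proof -
  note diff = bounded_bilinear.diff_left[OF bounded_bilinear_blinfun_compose, symmetric]
    bounded_bilinear.diff_right[OF bounded_bilinear_blinfun_compose, symmetric]
  have compose_norm: "norm (U o\<^sub>L Y) \<le> norm Y * norm U" for U :: "'a \<Rightarrow>\<^sub>L 'a"
    using norm_blinfun_compose[of U Y] by (simp add: mult.commute)
  have "\<exists>!Z. Z \<in> UNIV \<and> id_blinfun + (Y o\<^sub>L Z) = Z"
    using assms
    by (intro Banach_fix[where c = "norm Y", simplified])
      (auto simp: dist_norm diff norm_blinfun_compose complete_blinfun_UNIV)
  then obtain Z where Z: "id_blinfun + (Y o\<^sub>L Z) = Z" by blast
  have "\<exists>!W. W \<in> UNIV \<and> id_blinfun + (W o\<^sub>L Y) = W"
    using assms
    by (intro Banach_fix[where c = "norm Y", simplified])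
      (auto simp: dist_norm diff compose_norm complete_blinfun_UNIV)
  then obtain W where W: "id_blinfun + (W o\<^sub>L Y) = W" by blast
  have right: "(id_blinfun - Y) o\<^sub>L Z = id_blinfun"
  proof (rule blinfun_eqI)
    fix x
    have "Z x = x + Y (Z x)"
      using arg_cong[OF Z, of "\<lambda>T. T x"] by (simp add: blinfun.add_left)
    then show "((id_blinfun - Y) o\<^sub>L Z) x = id_blinfun x"
      by (simp add: blinfun.diff_left diff_eq_eq)
  qed
  have left: "W o\<^sub>L (id_blinfun - Y) = id_blinfun"
  proof (rule blinfun_eqI)
    fix x
    have "W x = x + W (Y x)"
      using arg_cong[OF W, of "\<lambda>T. T x"] by (simp add: blinfun.add_left)
    then show "(W o\<^sub>L (id_blinfun - Y)) x = id_blinfun x"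
      by (simp add: blinfun.diff_left blinfun.diff_right diff_eq_eq)
  qed
  have "W = W o\<^sub>L ((id_blinfun - Y) o\<^sub>L Z)" unfolding right by (intro blinfun_eqI) simp
  also have "\<dots> = (W o\<^sub>L (id_blinfun - Y)) o\<^sub>L Z" by (intro blinfun_eqI) simp
  also have "\<dots> = Z" unfolding left by (intro blinfun_eqI) simp
  finally show ?thesis using left right unfolding mutually_inverse_ops_def by blast
qed

text \<open>
  The equation says \<open>(I - Y)\<^sup>2 = I - E\<close>. On the operators of norm at most \<open>\<rho>\<close> the map
  \<open>Y \<mapsto> (E + Y\<^sup>2) / 2\<close> has Lipschitz constant \<open>\<rho>\<close>, and the bound on \<open>E\<close> is chosen to give
  \<open>(\<parallel>E\<parallel> + \<rho>\<^sup>2) / 2 \<le> \<rho>\<close>, so that the map does not leave this ball. Symmetry, positivity and commutation with everything that commutes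
  with \<open>E\<close> define closed conditions that the map preserves, so the fixed point inherits them.
\<close>

lemma half_square_fixpoint:
  fixes E :: "'a::{real_inner,complete_space} \<Rightarrow>\<^sub>L 'a"
  assumes sa: "\<And>x y. E x \<bullet> y = x \<bullet> E y" and pos: "\<And>x. 0 \<le> E x \<bullet> x"
    and "0 \<le> \<rho>" and "\<rho> < 1" and norm_E: "norm E \<le> 2 * \<rho> - \<rho>\<^sup>2"
  obtains Y :: "'a \<Rightarrow>\<^sub>L 'a" where "norm Y \<le> \<rho>" and "\<And>x. 2 *\<^sub>R Y x = E x + Y (Y x)"
    and "\<And>x y. Y x \<bullet> y = x \<bullet> Y y" and "\<And>x. 0 \<le> Y x \<bullet> x"
    and "\<And>U x. bounded_linear U \<Longrightarrow> (\<And>x. U (E x) = E (U x)) \<Longrightarrow> U (Y x) = Y (U x)"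
proof -
  define K :: "('a \<Rightarrow>\<^sub>L 'a) set" where "K = {Y. norm Y \<le> \<rho> \<and>
    (\<forall>x y. blinfun_apply Y x \<bullet> y = x \<bullet> blinfun_apply Y y) \<and>
    (\<forall>x. 0 \<le> blinfun_apply Y x \<bullet> x) \<and>
    (\<forall>U. bounded_linear U \<and> (\<forall>x. U (blinfun_apply E x) = blinfun_apply E (U x)) \<longrightarrow>
      (\<forall>x. U (blinfun_apply Y x) = blinfun_apply Y (U x)))}"
  define \<Phi> where "\<Phi> Y = (1/2) *\<^sub>R (E + (Y o\<^sub>L Y))" for Y :: "'a \<Rightarrow>\<^sub>L 'a"
  have \<Phi>_apply: "\<Phi> Y x = (1/2) *\<^sub>R (E x + Y (Y x))" for Y x
    by (simp add: \<Phi>_def blinfun.scaleR_left blinfun.add_left)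
  have "\<exists>!Y\<in>K. \<Phi> Y = Y"
  proof (rule Banach_fix[OF _ _ \<open>0 \<le> \<rho>\<close> \<open>\<rho> < 1\<close>])
    have "closed {Y. bounded_linear U \<and> (\<forall>x. U (blinfun_apply E x) = blinfun_apply E (U x)) \<longrightarrow>
        (\<forall>x. U (blinfun_apply Y x) = blinfun_apply Y (U x))}" for U :: "'a \<Rightarrow> 'a"
    proof (cases "bounded_linear U")
      case True
      show ?thesis
        by (intro closed_Collect_imp closed_Collect_all closed_Collect_eq open_Collect_const
            bounded_linear.continuous_on[OF True] continuous_intros)
    qed simp
    then have "closed K"
      unfolding K_def
      by (intro closed_Collect_conj closed_Collect_all closed_Collect_eq closed_Collect_le
          continuous_intros) blast+
    then show "complete K"
      using complete_Int_closed[OF complete_blinfun_UNIV] by simp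
    have "0 \<in> K"
      using \<open>0 \<le> \<rho>\<close> unfolding K_def by (auto simp: bounded_linear.linear linear_0)
    then show "K \<noteq> {}" by blast
    show "\<Phi> ` K \<subseteq> K"
    proof (rule image_subsetI)
      fix Y assume Y: "Y \<in> K"
      have norm_Y: "norm Y \<le> \<rho>" and sa_Y: "\<And>x y. Y x \<bullet> y = x \<bullet> Y y"
        and comm_Y: "\<And>U x. bounded_linear U \<Longrightarrow> (\<forall>x. U (E x) = E (U x)) \<Longrightarrow> U (Y x) = Y (U x)"
        using Y unfolding K_def by blast+
      have "norm (Y o\<^sub>L Y) \<le> \<rho>\<^sup>2"
        using norm_blinfun_compose[of Y Y] mult_mono[OF norm_Y norm_Y \<open>0 \<le> \<rho>\<close>]
        by (simp add: power2_eq_square)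
      then have "norm (\<Phi> Y) \<le> \<rho>"
        using norm_E norm_triangle_ineq[of E "Y o\<^sub>L Y"] by (simp add: \<Phi>_def)
      moreover have "\<Phi> Y x \<bullet> y = x \<bullet> \<Phi> Y y" for x y
        by (simp add: \<Phi>_apply inner_add_left inner_add_right sa sa_Y)
      moreover have "0 \<le> \<Phi> Y x \<bullet> x" for x
        using pos[of x] by (simp add: \<Phi>_apply inner_add_left sa_Y[of "Y x"])
      moreover have "U (\<Phi> Y x) = \<Phi> Y (U x)"
        if "bounded_linear U" "\<forall>x. U (E x) = E (U x)" for U x
        using that comm_Y[OF that] bounded_linear.linear[OF that(1)]
        by (simp add: \<Phi>_apply linear_add linear_scale)
      ultimately show "\<Phi> Y \<in> K" unfolding K_def by blast
    qed
    show "dist (\<Phi> Y) (\<Phi> Z) \<le> \<rho> * dist Y Z" if "Y \<in> K" "Z \<in> K" for Y Z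
    proof -
      have YZ: "norm Y \<le> \<rho>" "norm Z \<le> \<rho>" using that unfolding K_def by auto
      have "(Y o\<^sub>L Y) - (Z o\<^sub>L Z) = (Y o\<^sub>L (Y - Z)) + ((Y - Z) o\<^sub>L Z)"
        by (intro blinfun_eqI) (simp add: blinfun.bilinear_simps)
      then have "norm ((Y o\<^sub>L Y) - (Z o\<^sub>L Z)) \<le> norm (Y o\<^sub>L (Y - Z)) + norm ((Y - Z) o\<^sub>L Z)"
        by (simp add: norm_triangle_ineq)
      also have "\<dots> \<le> norm Y * norm (Y - Z) + norm (Y - Z) * norm Z"
        by (intro add_mono norm_blinfun_compose)
      also have "\<dots> \<le> \<rho> * norm (Y - Z) + norm (Y - Z) * \<rho>"
        using YZ by (intro add_mono mult_right_mono mult_left_mono) auto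
      finally show ?thesis
        by (simp add: dist_norm \<Phi>_def scaleR_diff_right[symmetric] mult.commute)
    qed
  qed
  then obtain Y where Y: "Y \<in> K" "\<Phi> Y = Y" by blast
  have "2 *\<^sub>R Y x = E x + Y (Y x)" for x
    using arg_cong[OF \<Phi>_apply[of Y x], of "(*\<^sub>R) 2"] unfolding Y(2) by simp
  then show thesis using that[of Y] Y(1) unfolding K_def by blast
qed

text \<open>
  Here \<open>A = M (I - Y)\<close> where \<open>Y\<close> solves \<open>Y = (E + Y\<^sup>2) / 2\<close> for \<open>E = I - D / M\<^sup>2\<close>. The bounds on \<open>D\<close>
  say \<open>0 \<le> E \<le> 1 - m\<^sup>2 / M\<^sup>2\<close>, and \<open>0 \<le> Y \<le> 1 - m / M\<close> turns into \<open>m I \<le> A \<le> M I\<close>.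
\<close>

lemma positive_square_root:
  fixes D :: "'a::{real_inner,complete_space} \<Rightarrow>\<^sub>L 'a"
  assumes "0 < m" and "m \<le> M"
    and sa: "\<And>x y. D x \<bullet> y = x \<bullet> D y"
    and lower: "\<And>x. m\<^sup>2 * (norm x)\<^sup>2 \<le> D x \<bullet> x" and upper: "\<And>x. D x \<bullet> x \<le> M\<^sup>2 * (norm x)\<^sup>2"
  obtains A B :: "'a \<Rightarrow>\<^sub>L 'a" where "mutually_inverse_ops A B" and "\<And>x. A (A x) = D x"
    and "op_le inner (m *\<^sub>R id_blinfun) A" and "op_le inner A (M *\<^sub>R id_blinfun)"
    and "\<forall>U. bounded_linear U \<and> (\<forall>x. U (D x) = D (U x)) \<longrightarrow> (\<forall>x. U (A x) = A (U x))"
proof -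
  have "M > 0" using assms by simp
  define E where "E = id_blinfun - (1 / M\<^sup>2) *\<^sub>R D"
  have E_apply: "E x = x - (1 / M\<^sup>2) *\<^sub>R D x" for x
    by (simp add: E_def blinfun.bilinear_simps)
  \<comment> \<open>the solution of \<open>2 \<rho> - \<rho>\<^sup>2 = 1 - m\<^sup>2 / M\<^sup>2\<close> below 1\<close>
  define \<rho> where "\<rho> = 1 - m / M"
  have \<rho>: "0 \<le> \<rho>" "\<rho> < 1" "2 * \<rho> - \<rho>\<^sup>2 = 1 - m\<^sup>2 / M\<^sup>2"
    using assms \<open>M > 0\<close> by (auto simp: \<rho>_def field_simps power2_eq_square)
  have sa_E: "E x \<bullet> y = x \<bullet> E y" for x y
    by (simp add: E_apply inner_diff_left inner_diff_right sa)
  have pos_E: "0 \<le> E x \<bullet> x" for x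
    using upper[of x] \<open>M > 0\<close>
    by (simp add: E_apply inner_diff_left power2_norm_eq_inner field_simps)
  have "norm E \<le> 2 * \<rho> - \<rho>\<^sup>2"
  proof (rule norm_positive_operator_le[OF sa_E pos_E])
    show "E x \<bullet> x \<le> (2 * \<rho> - \<rho>\<^sup>2) * (norm x)\<^sup>2" for x
      unfolding \<rho>(3) using lower[of x] \<open>M > 0\<close>
      by (simp add: E_apply inner_diff_left power2_norm_eq_inner field_simps)
    show "0 \<le> 2 * \<rho> - \<rho>\<^sup>2"
      unfolding \<rho>(3) using assms by (simp add: field_simps power_mono)
  qed
  then obtain Y :: "'a \<Rightarrow>\<^sub>L 'a" where norm_Y: "norm Y \<le> \<rho>"
    and fix_Y: "\<And>x. 2 *\<^sub>R Y x = E x + Y (Y x)"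
    and sa_Y: "\<And>x y. Y x \<bullet> y = x \<bullet> Y y" and pos_Y: "\<And>x. 0 \<le> Y x \<bullet> x"
    and comm_Y: "\<And>U x. bounded_linear U \<Longrightarrow> (\<And>x. U (E x) = E (U x)) \<Longrightarrow> U (Y x) = Y (U x)"
    using half_square_fixpoint[OF sa_E pos_E \<rho>(1,2)] by blast
  define A where "A = M *\<^sub>R (id_blinfun - Y)"
  have A_apply: "A x = M *\<^sub>R (x - Y x)" for x
    by (simp add: A_def blinfun.bilinear_simps)
  obtain Z where Z: "mutually_inverse_ops (id_blinfun - Y) Z"
    using neumann_inverse[of Y] norm_Y \<rho>(2) by auto
  have inverse: "mutually_inverse_ops A ((1 / M) *\<^sub>R Z)"
    using Z \<open>M > 0\<close> unfolding mutually_inverse_ops_def A_def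
    by (simp add: bounded_bilinear.scaleR_left[OF bounded_bilinear_blinfun_compose]
        bounded_bilinear.scaleR_right[OF bounded_bilinear_blinfun_compose])
  have square: "A (A x) = D x" for x
  proof -
    have "A (A x) = M\<^sup>2 *\<^sub>R (x - (2 *\<^sub>R Y x - Y (Y x)))"
      by (simp add: A_apply blinfun.bilinear_simps power2_eq_square algebra_simps scaleR_2)
    also have "\<dots> = M\<^sup>2 *\<^sub>R (x - E x)" by (simp add: fix_Y)
    also have "\<dots> = D x" using \<open>M > 0\<close> by (simp add: E_apply)
    finally show ?thesis .
  qed
  have Y_le: "Y x \<bullet> x \<le> \<rho> * (norm x)\<^sup>2" for x
  proof -
    have "Y x \<bullet> x \<le> norm (Y x) * norm x" by (rule norm_cauchy_schwarz)
    also have "\<dots> \<le> (norm Y * norm x) * norm x" by (intro mult_right_mono norm_blinfun) auto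
    also have "\<dots> \<le> (\<rho> * norm x) * norm x" using norm_Y by (intro mult_right_mono) auto
    finally show ?thesis by (simp add: power2_eq_square mult.assoc)
  qed
  have A_form: "A x \<bullet> x = M * (norm x)\<^sup>2 - M * (Y x \<bullet> x)" for x
    by (simp add: A_apply inner_diff_left power2_norm_eq_inner right_diff_distrib)
  have "m * (norm x)\<^sup>2 \<le> A x \<bullet> x" for x
  proof -
    have "M * (Y x \<bullet> x) \<le> M * (\<rho> * (norm x)\<^sup>2)"
      using Y_le \<open>M > 0\<close> by simp
    also have "\<dots> = M * (norm x)\<^sup>2 - m * (norm x)\<^sup>2"
      using \<open>M > 0\<close> by (simp add: \<rho>_def field_simps)
    finally show ?thesis by (simp add: A_form)
  qed
  moreover have "A x \<bullet> x \<le> M * (norm x)\<^sup>2" for x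
    using pos_Y[of x] \<open>M > 0\<close> by (simp add: A_form)
  moreover have "A x \<bullet> y = x \<bullet> A y" for x y
    by (simp add: A_apply inner_diff_left inner_diff_right sa_Y)
  ultimately have "op_le inner (m *\<^sub>R id_blinfun) A" "op_le inner A (M *\<^sub>R id_blinfun)"
    by (auto simp: op_le_def self_adjoint_op_def blinfun.scaleR_left power2_norm_eq_inner)
  moreover have "U (A x) = A (U x)" if U: "bounded_linear U" "\<And>x. U (D x) = D (U x)" for U x
  proof -
    interpret U: bounded_linear U by fact
    have "U (Y x) = Y (U x)"
      using U by (intro comm_Y) (auto simp: E_apply U.diff U.scaleR)
    then show ?thesis by (simp add: A_apply U.diff U.scaleR)
  qed
  ultimately show thesis using that[OF inverse square] by blast
qed

section \<open>Similarity to isometries\<close>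

text \<open>
  The last clause is what carries the result over to complex scalars, with \<open>U\<close> the multiplication
  by \<open>\<i>\<close>. If \<open>T\<close> and \<open>U T\<close> both belong to \<open>F\<close> and \<open>U T = T U\<close>, the invariant form satisfies
  \<open>b (U x) (U y) = b (T (U x)) (T (U y)) = b (U (T x)) (U (T y)) = b x y\<close>. For an orthogonal \<open>U\<close>
  this means that \<open>U\<close> commutes with the operator of \<open>b\<close>, hence with its square root \<open>A\<close>.
\<close>

lemma semigroup_similar_to_isometries:
  fixes F :: "('a::{real_inner,complete_space} \<Rightarrow> 'a) set"
  assumes "F \<noteq> {}" and "m > 0" and "M > 0"
    and lin: "\<And>T. T \<in> F \<Longrightarrow> linear T"
    and comp: "\<And>S T. S \<in> F \<Longrightarrow> T \<in> F \<Longrightarrow> S \<circ> T \<in> F"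
    and comm: "\<And>S T. S \<in> F \<Longrightarrow> T \<in> F \<Longrightarrow> S \<circ> T = T \<circ> S"
    and lower: "\<And>T x. T \<in> F \<Longrightarrow> m * norm x \<le> norm (T x)"
    and upper: "\<And>T x. T \<in> F \<Longrightarrow> norm (T x) \<le> M * norm x"
  obtains A B :: "'a \<Rightarrow>\<^sub>L 'a" where "mutually_inverse_ops A B"
    and "op_le inner (m *\<^sub>R id_blinfun) A" and "op_le inner A (M *\<^sub>R id_blinfun)"
    and "\<And>T x. T \<in> F \<Longrightarrow> norm (A (T x)) = norm (A x)"
    and "\<forall>U T. bounded_linear U \<and> surj U \<and> (\<forall>x y. U x \<bullet> U y = x \<bullet> y) \<and>
      T \<in> F \<and> U \<circ> T \<in> F \<and> U \<circ> T = T \<circ> U \<longrightarrow> (\<forall>x. U (A x) = A (U x))"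
proof (cases "m \<le> M")
  case False
  \<comment> \<open>the two bounds contradict each other at any nonzero vector, so the space is zero\<close>
  obtain T where "T \<in> F" using \<open>F \<noteq> {}\<close> by blast
  have zero: "x = 0" for x :: 'a
  proof (rule ccontr)
    assume "x \<noteq> 0"
    moreover have "m * norm x \<le> M * norm x"
      using lower[OF \<open>T \<in> F\<close>] upper[OF \<open>T \<in> F\<close>] by (rule order_trans)
    ultimately show False using False by simp
  qed
  have all_eq: "x = y" for x y :: 'a
    using zero[of x] zero[of y] by simp
  have "x \<bullet> y = 0" for x y :: 'a
    using zero[of x] by simp
  then have op_le: "op_le inner S T" for S T :: "'a \<Rightarrow>\<^sub>L 'a"
    by (simp add: op_le_def self_adjoint_op_def)
  have "mutually_inverse_ops id_blinfun (id_blinfun :: 'a \<Rightarrow>\<^sub>L 'a)"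
    unfolding mutually_inverse_ops_def by (intro conjI blinfun_eqI) simp_all
  then show thesis
    by (rule that) (rule op_le, rule op_le, rule arg_cong[OF all_eq], intro allI impI, rule all_eq)
next
  case True
  obtain b where b_linear: "\<And>y. linear (\<lambda>x. b x y)" and b_sym: "\<And>x y. b x y = b y x"
    and b_bound: "\<And>x y. \<bar>b x y\<bar> \<le> M\<^sup>2 * (norm x * norm y)"
    and b_lower: "\<And>x. m\<^sup>2 * (norm x)\<^sup>2 \<le> b x x"
    and b_inv: "\<And>T x y. T \<in> F \<Longrightarrow> b (T x) (T y) = b x y"
    using \<open>F \<noteq> {}\<close> less_imp_le[OF \<open>m > 0\<close>] less_imp_le[OF \<open>M > 0\<close>] lin comp comm lower upper
    by (rule invariant_bilinear_form) (assumption | rule that)+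
  have b_linear': "linear (b x)" for x
    using b_linear[of x] unfolding b_sym[of _ x] .
  obtain D :: "'a \<Rightarrow>\<^sub>L 'a" where D: "\<And>x y. D x \<bullet> y = b x y"
    using bounded_form_operator[of b "M\<^sup>2", OF b_linear b_linear' b_bound] by blast
  have D_sa: "D x \<bullet> y = x \<bullet> D y" for x y
    by (simp only: D inner_commute[of x] b_sym[of y])
  have D_lower: "m\<^sup>2 * (norm x)\<^sup>2 \<le> D x \<bullet> x" and D_upper: "D x \<bullet> x \<le> M\<^sup>2 * (norm x)\<^sup>2" for x
    using b_lower[of x] b_bound[of x x] by (simp_all add: D power2_eq_square abs_le_iff)
  obtain A B :: "'a \<Rightarrow>\<^sub>L 'a" where inverse: "mutually_inverse_ops A B" and square: "\<And>x. A (A x) = D x"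
    and bounds: "op_le inner (m *\<^sub>R id_blinfun) A" "op_le inner A (M *\<^sub>R id_blinfun)"
    and commute: "\<forall>U. bounded_linear U \<and> (\<forall>x. U (D x) = D (U x)) \<longrightarrow> (\<forall>x. U (A x) = A (U x))"
    using \<open>m > 0\<close> True D_sa D_lower D_upper
    by (rule positive_square_root) (assumption | rule that)+
  have A_sa: "A x \<bullet> y = x \<bullet> A y" for x y
    using bounds(1) unfolding op_le_def self_adjoint_op_def by blast
  have norm_A: "(norm (A x))\<^sup>2 = b x x" for x
  proof -
    have "(norm (A x))\<^sup>2 = x \<bullet> A (A x)" by (simp only: power2_norm_eq_inner A_sa)
    also have "\<dots> = D x \<bullet> x" by (simp only: square inner_commute)
    finally show ?thesis by (simp only: D)
  qed
  have norm_inv: "norm (A (T x)) = norm (A x)" if "T \<in> F" for T x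
  proof -
    have "(norm (A (T x)))\<^sup>2 = (norm (A x))\<^sup>2"
      unfolding norm_A using b_inv[OF that] .
    then show ?thesis by simp
  qed
  have U_commute: "U (A x) = A (U x)"
    if U: "bounded_linear U" "surj U" "\<forall>x y. U x \<bullet> U y = x \<bullet> y"
      and T: "T \<in> F" "U \<circ> T \<in> F" "U \<circ> T = T \<circ> U" for U T x
  proof -
    have U_inner: "U x \<bullet> U y = x \<bullet> y" for x y using U(3) by blast
    have "U (D x) \<bullet> z = D (U x) \<bullet> z" for x z
    proof -
      obtain y where y: "z = U y" using \<open>surj U\<close> by blast
      have "U (D x) \<bullet> z = b x y" unfolding y U_inner D ..
      also have "\<dots> = b ((U \<circ> T) x) ((U \<circ> T) y)" by (rule b_inv[OF T(2), symmetric])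
      also have "\<dots> = b (T (U x)) (T (U y))" unfolding T(3) by simp
      also have "\<dots> = b (U x) (U y)" by (rule b_inv[OF T(1)])
      also have "\<dots> = D (U x) \<bullet> z" unfolding y D ..
      finally show ?thesis .
    qed
    then have "U (D x) = D (U x)" for x
      by (rule vector_eq_rdot[THEN iffD1, OF allI])
    with U(1) have "bounded_linear U \<and> (\<forall>x. U (D x) = D (U x))" by blast
    then show ?thesis by (rule commute[THEN spec, THEN mp, THEN spec])
  qed
  show thesis
    by (rule that[OF inverse bounds])
      (rule norm_inv, assumption, intro allI impI, elim conjE, rule U_commute)
qed

lemma isometry_conjugate:
  fixes A B T :: "'a::real_normed_vector \<Rightarrow>\<^sub>L 'a"
  assumes "mutually_inverse_ops A B" and "\<And>x. norm (A (T x)) = norm (A x)"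
  shows "isometry_op (A o\<^sub>L T o\<^sub>L B)"
proof -
  have "A (B x) = x" for x
    using assms(1) unfolding mutually_inverse_ops_def
    by (metis blinfun_apply_blinfun_compose blinfun_apply_id_blinfun)
  then show ?thesis by (simp add: isometry_op_def assms(2))
qed

lemma positive_op_if_ge_scaled_id:
  fixes A :: "'a::real_inner \<Rightarrow>\<^sub>L 'a"
  assumes "op_le inner (m *\<^sub>R id_blinfun) A" and "m \<ge> 0"
  shows "positive_op inner A"
  unfolding positive_op_def op_le_def
proof (intro conjI allI)
  show "self_adjoint_op inner 0" by (simp add: self_adjoint_op_def)
  show "self_adjoint_op inner A" using assms(1) by (simp add: op_le_def)
  fix x :: 'a
  have "0 \<le> m * (x \<bullet> x)" using \<open>m \<ge> 0\<close> by simp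
  also have "\<dots> \<le> A x \<bullet> x"
    using assms(1) unfolding op_le_def by (simp add: blinfun.scaleR_left)
  finally show "blinfun_apply 0 x \<bullet> x \<le> A x \<bullet> x" by simp
qed

section \<open>Complex scalars\<close>

lemma scaleC_scaleR_commute: "scaleC c (r *\<^sub>R x) = r *\<^sub>R scaleC c x"
  by (simp add: scaleC_of_real[symmetric] scaleC_scaleC mult.commute)

lemma inner_scaleC_scaleC:
  "inner (scaleC c x) (scaleC c y) = (cmod c)\<^sup>2 * inner x y"
proof -
  have "cinner x (scaleC c y) = cnj c * cinner x y"
    using cinner_scaleC_left[of c y x] cinner_commute[of x "scaleC c y"] cinner_commute[of x y] by simp
  then have "cinner (scaleC c x) (scaleC c y) = (c * cnj c) * cinner x y"
    by (simp add: cinner_scaleC_left mult.assoc)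
  also have "\<dots> = complex_of_real ((cmod c)\<^sup>2) * cinner x y"
    by (simp only: complex_norm_square)
  finally show ?thesis
    by (simp only: Re_cinner[symmetric] Re_complex_of_real Im_complex_of_real times_complex.sel)
qed

lemma norm_scaleC: "norm (scaleC c x) = cmod c * norm x"
  by (simp add: norm_eq_sqrt_inner inner_scaleC_scaleC real_sqrt_mult)

lemma bounded_linear_scaleC: "bounded_linear (scaleC c)"
  by (intro bounded_linear_intro[where K = "cmod c"])
    (simp_all add: scaleC_add_right scaleC_scaleR_commute norm_scaleC mult.commute)

lemma scaleC_one: "scaleC 1 x = x"
  using scaleC_of_real[of 1 x] by simp

lemma scaleC_decompose: "scaleC c x = Re c *\<^sub>R x + Im c *\<^sub>R scaleC \<i> x"
proof -
  have "c = complex_of_real (Re c) + complex_of_real (Im c) * \<i>"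
    by (simp add: complex_eq_iff)
  then have "scaleC c x = scaleC (complex_of_real (Re c) + complex_of_real (Im c) * \<i>) x"
    by (rule arg_cong)
  then show ?thesis
    by (simp only: scaleC_add_left scaleC_scaleC[symmetric] scaleC_of_real)
qed

lemma bounded_clinear_opsI:
  fixes T :: "'a::complex_inner \<Rightarrow>\<^sub>L 'a"
  assumes "\<And>x. T (scaleC \<i> x) = scaleC \<i> (T x)"
  shows "T \<in> bounded_clinear_ops"
  unfolding bounded_clinear_ops_def mem_Collect_eq
proof (intro allI)
  fix c x
  show "T (scaleC c x) = scaleC c (T x)"
    unfolding scaleC_decompose[of c] by (simp add: blinfun.add_right blinfun.scaleR_right assms)
qed

lemma bounded_clinear_ops_inverse:
  fixes A B :: "'a::complex_inner \<Rightarrow>\<^sub>L 'a"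
  assumes "mutually_inverse_ops A B" and "A \<in> bounded_clinear_ops"
  shows "B \<in> bounded_clinear_ops"
proof (rule bounded_clinear_opsI)
  have AB: "A (B y) = y" and BA: "B (A y) = y" for y
    using assms(1) unfolding mutually_inverse_ops_def
    by (metis blinfun_apply_blinfun_compose blinfun_apply_id_blinfun)+
  fix x
  have "A (scaleC \<i> (B x)) = scaleC \<i> x"
    using assms(2) AB unfolding bounded_clinear_ops_def by simp
  then show "B (scaleC \<i> x) = scaleC \<i> (B x)"
    using BA[of "scaleC \<i> (B x)"] by simp
qed

text \<open>
  The real part of \<open>cinner\<close> is \<open>inner\<close>, and its imaginary part is \<open>inner\<close> after multiplying one
  argument by \<open>- \<i>\<close>; complex linear operators therefore inherit self-adjointness, and the quadratic
  form of a self-adjoint operator is real.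
\<close>

lemma op_le_cinnerI:
  fixes A B :: "'a::complex_inner \<Rightarrow>\<^sub>L 'a"
  assumes "A \<in> bounded_clinear_ops" and "B \<in> bounded_clinear_ops" and "op_le inner A B"
  shows "op_le cinner A B"
proof -
  have Im_cinner: "Im (cinner x y) = inner (scaleC (- \<i>) x) y" for x y :: 'a
    by (simp add: Re_cinner[symmetric] cinner_scaleC_left)
  have sa: "self_adjoint_op cinner T"
    if T: "T \<in> bounded_clinear_ops" "self_adjoint_op inner T" for T :: "'a \<Rightarrow>\<^sub>L 'a"
    unfolding self_adjoint_op_def
  proof (intro allI complex_eqI)
    have T_sa: "inner (T u) v = inner u (T v)" for u v
      using T(2) by (simp add: self_adjoint_op_def)
    have T_scaleC: "scaleC c (T u) = T (scaleC c u)" for c u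
      using T(1) by (simp add: bounded_clinear_ops_def)
    fix x y
    show "Re (cinner (T x) y) = Re (cinner x (T y))" by (simp only: Re_cinner T_sa)
    show "Im (cinner (T x) y) = Im (cinner x (T y))" by (simp only: Im_cinner T_scaleC T_sa)
  qed
  have real: "Im (cinner (T x) x) = 0"
    if "self_adjoint_op cinner T" for T :: "'a \<Rightarrow>\<^sub>L 'a" and x
  proof -
    have "cinner (T x) x = cnj (cinner (T x) x)"
      using that cinner_commute[of x "T x"] by (simp add: self_adjoint_op_def)
    then show ?thesis by (simp add: complex_eq_iff)
  qed
  show ?thesis
    using assms sa real unfolding op_le_def by (simp add: less_eq_complex_def Re_cinner)
qed

lemma scaled_id_bounded_clinear: "r *\<^sub>R id_blinfun \<in> bounded_clinear_ops"
  by (simp add: bounded_clinear_ops_def blinfun.scaleR_left scaleC_scaleR_commute)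

theorem theorem1p4:
  fixes \<T> :: "('a::{real_inner,complete_space} \<Rightarrow>\<^sub>L 'a) set"
    and \<S> :: "('b::{complex_inner,complete_space} \<Rightarrow>\<^sub>L 'b) set"
    and m M :: real
  assumes "m > 0" and "M > 0"
  shows
    "(bounded \<T> \<and> abelian_op_semigroup \<T> \<and>
      (\<forall>T\<in>\<T>. \<forall>x. m * norm x \<le> norm (blinfun_apply T x) \<and>
        norm (blinfun_apply T x) \<le> M * norm x)
      \<longrightarrow> (\<exists>A B. mutually_inverse_ops A B \<and> positive_op inner A \<and>
            op_le inner (m *\<^sub>R id_blinfun) A \<and> op_le inner A (M *\<^sub>R id_blinfun) \<and>
            (\<forall>T\<in>\<T>. isometry_op (A o\<^sub>L T o\<^sub>L B))))
     \<and>
     (\<S> \<subseteq> bounded_clinear_ops \<and> bounded \<S> \<and> abelian_op_semigroup \<S> \<and>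
      (\<forall>T\<in>\<S>. \<forall>x. m * norm x \<le> norm (blinfun_apply T x) \<and>
        norm (blinfun_apply T x) \<le> M * norm x)
      \<longrightarrow> (\<exists>A\<in>bounded_clinear_ops. \<exists>B\<in>bounded_clinear_ops.
            mutually_inverse_ops A B \<and> positive_op cinner A \<and>
            op_le cinner (m *\<^sub>R id_blinfun) A \<and> op_le cinner A (M *\<^sub>R id_blinfun) \<and>
            (\<forall>T\<in>\<S>. isometry_op (A o\<^sub>L T o\<^sub>L B))))"
proof (intro conjI impI)
  assume T: "bounded \<T> \<and> abelian_op_semigroup \<T> \<and>
    (\<forall>T\<in>\<T>. \<forall>x. m * norm x \<le> norm (blinfun_apply T x) \<and> norm (blinfun_apply T x) \<le> M * norm x)"
  define F where "F = blinfun_apply ` \<T>"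
  have "F \<noteq> {}" using T by (simp add: F_def abelian_op_semigroup_def)
  moreover note \<open>m > 0\<close> \<open>M > 0\<close>
  moreover have "linear f" if "f \<in> F" for f
    using that by (auto simp: F_def intro: bounded_linear.linear blinfun.bounded_linear_right)
  moreover have "f \<circ> g \<in> F" "f \<circ> g = g \<circ> f" if "f \<in> F" "g \<in> F" for f g
    using that T unfolding F_def abelian_op_semigroup_def
    by (auto simp: blinfun_compose.rep_eq[symmetric])
  moreover have "m * norm x \<le> norm (f x)" "norm (f x) \<le> M * norm x" if "f \<in> F" for f x
    using that T by (auto simp: F_def)
  ultimately obtain A B :: "'a \<Rightarrow>\<^sub>L 'a" where AB: "mutually_inverse_ops A B"
    "op_le inner (m *\<^sub>R id_blinfun) A" "op_le inner A (M *\<^sub>R id_blinfun)"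
    and norm_A: "\<And>f x. f \<in> F \<Longrightarrow> norm (A (f x)) = norm (A x)"
    by (rule semigroup_similar_to_isometries) (assumption | rule that)+
  have "isometry_op (A o\<^sub>L T o\<^sub>L B)" if "T \<in> \<T>" for T
    using that by (intro isometry_conjugate[OF AB(1)] norm_A) (simp add: F_def)
  moreover have "positive_op inner A"
    using positive_op_if_ge_scaled_id[OF AB(2)] assms by simp
  ultimately show "\<exists>A B. mutually_inverse_ops A B \<and> positive_op inner A \<and>
      op_le inner (m *\<^sub>R id_blinfun) A \<and> op_le inner A (M *\<^sub>R id_blinfun) \<and>
      (\<forall>T\<in>\<T>. isometry_op (A o\<^sub>L T o\<^sub>L B))"
    using AB by blast
next
  assume S: "\<S> \<subseteq> bounded_clinear_ops \<and> bounded \<S> \<and> abelian_op_semigroup \<S> \<and>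
    (\<forall>T\<in>\<S>. \<forall>x. m * norm x \<le> norm (blinfun_apply T x) \<and> norm (blinfun_apply T x) \<le> M * norm x)"
  have S_scaleC: "T (scaleC c x) = scaleC c (T x)" if "T \<in> \<S>" for T c x
    using that S by (auto simp: bounded_clinear_ops_def)
  \<comment> \<open>the unimodular multiples force the operator \<open>A\<close> of the real result to be complex linear\<close>
  define F where "F = {scaleC c \<circ> blinfun_apply T | c T. cmod c = 1 \<and> T \<in> \<S>}"
  have F_I: "scaleC c \<circ> blinfun_apply T \<in> F" if "cmod c = 1" "T \<in> \<S>" for c T
    using that unfolding F_def by blast
  obtain T where T: "T \<in> \<S>" using S by (auto simp: abelian_op_semigroup_def)
  have T_F: "blinfun_apply U \<in> F" if "U \<in> \<S>" for U
    using F_I[of 1 U] that by (simp add: comp_def scaleC_one)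
  have "F \<noteq> {}" using T_F[OF T] by blast
  moreover note \<open>m > 0\<close> \<open>M > 0\<close>
  moreover have "linear f" if "f \<in> F" for f
    using that unfolding F_def
    by (auto intro!: linear_compose intro: bounded_linear.linear bounded_linear_scaleC
        blinfun.bounded_linear_right)
  moreover have "f \<circ> g \<in> F" "f \<circ> g = g \<circ> f" if "f \<in> F" "g \<in> F" for f g
  proof -
    obtain c U d V where f: "f = scaleC c \<circ> blinfun_apply U" "cmod c = 1" "U \<in> \<S>"
      and g: "g = scaleC d \<circ> blinfun_apply V" "cmod d = 1" "V \<in> \<S>"
      using \<open>f \<in> F\<close> \<open>g \<in> F\<close> unfolding F_def by blast
    have fg: "f \<circ> g = scaleC (c * d) \<circ> blinfun_apply (U o\<^sub>L V)"
      using f g by (simp add: fun_eq_iff S_scaleC scaleC_scaleC)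
    have gf: "g \<circ> f = scaleC (c * d) \<circ> blinfun_apply (V o\<^sub>L U)"
      using f g by (simp add: fun_eq_iff S_scaleC scaleC_scaleC mult.commute)
    have "U o\<^sub>L V \<in> \<S>" "U o\<^sub>L V = V o\<^sub>L U"
      using S f(3) g(3) unfolding abelian_op_semigroup_def by blast+
    then show "f \<circ> g \<in> F" "f \<circ> g = g \<circ> f"
      using F_I[of "c * d"] f(2) g(2) fg gf by (simp_all add: norm_mult)
  qed
  moreover have "m * norm x \<le> norm (f x)" "norm (f x) \<le> M * norm x" if "f \<in> F" for f x
    using that S by (auto simp: F_def norm_scaleC)
  ultimately obtain A B :: "'b \<Rightarrow>\<^sub>L 'b" where AB: "mutually_inverse_ops A B"
    "op_le inner (m *\<^sub>R id_blinfun) A" "op_le inner A (M *\<^sub>R id_blinfun)"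
    and norm_A: "\<And>f x. f \<in> F \<Longrightarrow> norm (A (f x)) = norm (A x)"
    and commute: "\<forall>U T. bounded_linear U \<and> surj U \<and> (\<forall>x y. U x \<bullet> U y = x \<bullet> y) \<and>
      T \<in> F \<and> U \<circ> T \<in> F \<and> U \<circ> T = T \<circ> U \<longrightarrow> (\<forall>x. U (A x) = A (U x))"
    by (rule semigroup_similar_to_isometries) (assumption | rule that)+
  have A: "A \<in> bounded_clinear_ops"
  proof -
    have "scaleC \<i> (scaleC (- \<i>) x) = x" for x :: 'b
      by (simp add: scaleC_scaleC scaleC_one)
    then have "surj (scaleC \<i> :: 'b \<Rightarrow> 'b)" by (rule surjI)
    moreover have "\<forall>x y :: 'b. scaleC \<i> x \<bullet> scaleC \<i> y = x \<bullet> y"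
      by (simp add: inner_scaleC_scaleC)
    moreover have "scaleC \<i> \<circ> blinfun_apply T \<in> F"
      using F_I[OF _ T] by simp
    moreover have "scaleC \<i> \<circ> blinfun_apply T = blinfun_apply T \<circ> scaleC \<i>"
      using S_scaleC[OF T] by (simp add: fun_eq_iff)
    ultimately have "scaleC \<i> (A x) = A (scaleC \<i> x)" for x
      using T_F[OF T] bounded_linear_scaleC
      by (intro commute[THEN spec, THEN spec, THEN mp, THEN spec, of _ "blinfun_apply T"] conjI)
    then show ?thesis by (intro bounded_clinear_opsI) simp
  qed
  have B: "B \<in> bounded_clinear_ops"
    using bounded_clinear_ops_inverse[OF AB(1) A] .
  have "isometry_op (A o\<^sub>L T o\<^sub>L B)" if "T \<in> \<S>" for T
    using that by (intro isometry_conjugate[OF AB(1)] norm_A T_F)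
  moreover have "op_le cinner (m *\<^sub>R id_blinfun) A" "op_le cinner A (M *\<^sub>R id_blinfun)"
    using op_le_cinnerI scaled_id_bounded_clinear A AB(2,3) by blast+
  moreover have "positive_op cinner A"
    using positive_op_if_ge_scaled_id[OF AB(2)] op_le_cinnerI[OF _ A]
      scaled_id_bounded_clinear[of 0] assms unfolding positive_op_def by simp
  ultimately show "\<exists>A\<in>bounded_clinear_ops. \<exists>B\<in>bounded_clinear_ops.
      mutually_inverse_ops A B \<and> positive_op cinner A \<and>
      op_le cinner (m *\<^sub>R id_blinfun) A \<and> op_le cinner A (M *\<^sub>R id_blinfun) \<and>
      (\<forall>T\<in>\<S>. isometry_op (A o\<^sub>L T o\<^sub>L B))"
    using A B AB(1) by blast
qed

end
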